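(* Let $n\ge 2$ be an integer and let $T$ be the 2-torus in $\mathbb{R}^3$ with radii $a>r>0$. Then there exist real constants $a_1,\dots,a_{n+1}$ with $a_1\neq 0$ and a real constant $p$ such that $T$ is a critical point of the functional $$\mathcal{F}_n=\int_S \mathcal{E}_n\,dA+p\int_V dV,\qquad \mathcal{E}_n=a_1H^n+a_2H^{n-1}+\cdots+a_nH+a_{n+1},$$ if and only if $$\frac{a^2}{r^2}=\frac{n^2-n}{n^2-n-1}.$$
   Context: The 2-torus $T\subset\mathbb{R}^3$ with radii $a>r>0$ is parametrized by $X(u,v)=((a+r\cos u)\cos v,\ (a+r\cos u)\sin v,\ r\sin u)$, with $u,v$ ranging over a full period $2\pi$. Its first fundamental form is $g_{ij}dx^idx^j=r^2du^2+(a+r\cos u)^2dv^2$, with $x^i=(u,v)$. With the sign convention used here, its Gaussian and mean curvatures are $$K=\frac{\cos u}{r(a+r\cos u)},\qquad H=\frac12\left(\frac1r+\frac{\cos u}{a+r\cos u}\right).$$ For a closed surface $S\subset\mathbb{R}^3$ with mean curvature $H$ and Gaussian curvature $K$, enclosing the region $V$, a twice differentiable function $\mathcal{E}$ of $H$, and a constant $p\in\mathbb{R}$, consider $\mathcal{F}=\int_S\mathcal{E}(H)\,dA+p\int_V dV$. The surface $S$ is called a critical point of $\mathcal{F}$ if the Euler–Lagrange equation $$(\nabla^2+4H^2-2K)\frac{\partial\mathcal{E}}{\partial H}-4H\,\mathcal{E}+2p=0$$ holds at every point of $S$. Here $\nabla^2=\frac{1}{\sqrt g}\frac{\partial}{\partial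 x^i}\left(\sqrt g\,g^{ij}\frac{\partial}{\partial x^j}\right)$ is the Laplace–Beltrami operator of $S$, with $g=\det(g_{ij})$ and $(g^{ij})$ the inverse of $(g_{ij})$. *)

theory Defs
  imports "HOL-Analysis.Analysis"
begin

text \<open>
  A parametrized surface is a map \<open>X :: real^2 \<Rightarrow> real^3\<close>, the components of the argument being
  the coordinates \<open>x\<^sup>1, x\<^sup>2\<close>.  All notions below are meant for smooth \<open>X\<close> with linearly
  independent partial derivatives.
\<close>

definition partial_deriv :: "2 \<Rightarrow> (real^2 \<Rightarrow> 'a::real_normed_vector) \<Rightarrow> real^2 \<Rightarrow> 'a" where
  "partial_deriv i f x = vector_derivative (\<lambda>t. f (x + t *\<^sub>R axis i 1)) (at 0)"

definition first_form :: "(real^2 \<Rightarrow> real^3) \<Rightarrow> real^2 \<Rightarrow> real^2^2" where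
  "first_form X x = (\<chi> i j. partial_deriv i X x \<bullet> partial_deriv j X x)"

definition unit_normal :: "(real^2 \<Rightarrow> real^3) \<Rightarrow> real^2 \<Rightarrow> real^3" where
  "unit_normal X x = sgn (cross3 (partial_deriv 1 X x) (partial_deriv 2 X x))"

definition second_form :: "(real^2 \<Rightarrow> real^3) \<Rightarrow> real^2 \<Rightarrow> real^2^2" where
  "second_form X x = (\<chi> i j. partial_deriv i (partial_deriv j X) x \<bullet> unit_normal X x)"

text \<open>
  The sign of the mean curvature depends on the orientation of \<open>X\<close>: it is positive for a round
  sphere parametrized so that the unit normal points inwards.
\<close>

definition mean_curvature :: "(real^2 \<Rightarrow> real^3) \<Rightarrow> real^2 \<Rightarrow> real" where
  "mean_curvature X x = trace (matrix_inv (first_form X x) ** second_form X x) / 2"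

definition gauss_curvature :: "(real^2 \<Rightarrow> real^3) \<Rightarrow> real^2 \<Rightarrow> real" where
  "gauss_curvature X x = det (second_form X x) / det (first_form X x)"

definition laplace_beltrami :: "(real^2 \<Rightarrow> real^3) \<Rightarrow> (real^2 \<Rightarrow> real) \<Rightarrow> real^2 \<Rightarrow> real" where
  "laplace_beltrami X f x =
     1 / sqrt (det (first_form X x)) *
     (\<Sum>i\<in>UNIV. partial_deriv i
        (\<lambda>y. \<Sum>j\<in>UNIV. sqrt (det (first_form X y)) * matrix_inv (first_form X y) $ i $ j
                        * partial_deriv j f y) x)"

text \<open>
  Critical points of \<open>\<integral> \<E>(H) dA + p \<integral> dV\<close> for a closed surface covered by \<open>X\<close>, in the sense of
  the Euler--Lagrange equation holding at every point.  The unit normal of \<open>X\<close> has to point into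
  the enclosed region.
\<close>

definition critical_point ::
  "(real^2 \<Rightarrow> real^3) \<Rightarrow> (real \<Rightarrow> real) \<Rightarrow> real \<Rightarrow> bool" where
  "critical_point X \<E> p \<longleftrightarrow>
     (\<forall>x. laplace_beltrami X (\<lambda>y. deriv \<E> (mean_curvature X y)) x
          + (4 * (mean_curvature X x)\<^sup>2 - 2 * gauss_curvature X x) * deriv \<E> (mean_curvature X x)
          - 4 * mean_curvature X x * \<E> (mean_curvature X x) + 2 * p = 0)"

text \<open>
  The coordinates are \<open>(u, v) = (x $ 1, x $ 2)\<close>.  They range over all of \<open>\<real>\<^sup>2\<close>; the map is
  \<open>2\<pi>\<close>-periodic in both, so this covers exactly the points of the torus.
\<close>

definition torus :: "real \<Rightarrow> real \<Rightarrow> real^2 \<Rightarrow> real^3" where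
  "torus a r x = vector [(a + r * cos (x $ 1)) * cos (x $ 2),
                         (a + r * cos (x $ 1)) * sin (x $ 2),
                         r * sin (x $ 1)]"

definition poly_energy :: "nat \<Rightarrow> (nat \<Rightarrow> real) \<Rightarrow> real \<Rightarrow> real" where
  "poly_energy n c H = (\<Sum>i = 1..n + 1. c i * H ^ (n + 1 - i))"


lemma partial_derivI:
  assumes "((\<lambda>t. f (x + t *\<^sub>R axis i 1)) has_vector_derivative d) (at 0)"
  shows "partial_deriv i f x = d"
  unfolding partial_deriv_def using assms by (rule vector_derivative_at)

lemma vector3_sum_axis:
  "(vector [p, q, s] :: real^3) = p *\<^sub>R axis 1 1 + q *\<^sub>R axis 2 1 + s *\<^sub>R axis 3 1"
  by (simp add: vec_eq_iff forall_3 axis_def)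

lemma has_vector_derivative_vector3:
  assumes "(f has_real_derivative f') (at t within S)" "(g has_real_derivative g') (at t within S)"
    "(h has_real_derivative h') (at t within S)"
  shows "((\<lambda>t. vector [f t, g t, h t] :: real^3) has_vector_derivative vector [f', g', h'])
    (at t within S)"
proof -
  have *: "((\<lambda>t. k t *\<^sub>R b) has_vector_derivative k' *\<^sub>R b) (at t within S)"
    if "(k has_real_derivative k') (at t within S)" for k k' and b :: "real^3"
    using has_vector_derivative_scaleR[OF that has_vector_derivative_const] by simp
  show ?thesis
    unfolding vector3_sum_axis by (intro has_vector_derivative_add * assms)
qed

lemma partial_deriv_torus:
  "partial_deriv 1 (torus a r) = (\<lambda>x. vector [- r * sin (x $ 1) * cos (x $ 2),
     - r * sin (x $ 1) * sin (x $ 2), r * cos (x $ 1)])"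
  "partial_deriv 2 (torus a r) = (\<lambda>x. vector [- (a + r * cos (x $ 1)) * sin (x $ 2),
     (a + r * cos (x $ 1)) * cos (x $ 2), 0])"
  unfolding fun_eq_iff torus_def
  by (intro allI partial_derivI has_vector_derivative_vector3;
      auto intro!: derivative_eq_intros simp: axis_def algebra_simps)+

lemma partial_deriv2_torus:
  "partial_deriv 1 (partial_deriv 1 (torus a r)) x = vector [- r * cos (x $ 1) * cos (x $ 2),
     - r * cos (x $ 1) * sin (x $ 2), - r * sin (x $ 1)]"
  "partial_deriv 2 (partial_deriv 1 (torus a r)) x = vector [r * sin (x $ 1) * sin (x $ 2),
     - r * sin (x $ 1) * cos (x $ 2), 0]"
  "partial_deriv 1 (partial_deriv 2 (torus a r)) x = vector [r * sin (x $ 1) * sin (x $ 2),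
     - r * sin (x $ 1) * cos (x $ 2), 0]"
  "partial_deriv 2 (partial_deriv 2 (torus a r)) x =
     vector [- (a + r * cos (x $ 1)) * cos (x $ 2), - (a + r * cos (x $ 1)) * sin (x $ 2), 0]"
  unfolding partial_deriv_torus
  by (intro partial_derivI has_vector_derivative_vector3;
      auto intro!: derivative_eq_intros simp: axis_def algebra_simps)+

lemma matrix_inv_eqI:
  fixes A :: "'a::semiring_1^'n^'m"
  assumes "A ** B = mat 1" "B ** A = mat 1"
  shows "matrix_inv A = B"
proof -
  have "A ** matrix_inv A = mat 1 \<and> matrix_inv A ** A = mat 1"
    unfolding matrix_inv_def by (rule someI[of _ B]) (use assms in simp)
  then show ?thesis
    by (metis assms(2) matrix_mul_assoc matrix_mul_lid matrix_mul_rid)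
qed

context
  fixes a r :: real
  assumes r_pos: "0 < r" and r_less_a: "r < a"
begin

lemma torus_radius_pos: "0 < a + r * cos t"
proof -
  have "r * (- 1) \<le> r * cos t"
    using r_pos by (intro mult_left_mono) auto
  with r_less_a show ?thesis by simp
qed

lemma first_form_torus:
  "first_form (torus a r) x = vector [vector [r\<^sup>2, 0], vector [0, (a + r * cos (x $ 1))\<^sup>2]]"
proof -
  have s: "(sin t)\<^sup>2 = 1 - (cos t)\<^sup>2" for t :: real by (rule sin_squared_eq)
  show ?thesis
    using s[of "x $ 1"] s[of "x $ 2"]
    apply (simp add: first_form_def partial_deriv_torus vec_eq_iff forall_2 inner_vec_def sum_3)
    apply (intro conjI)
       apply algebra
      apply (simp add: algebra_simps)
     apply (simp add: algebra_simps)
    apply algebra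
    done
qed

lemma unit_normal_torus:
  "unit_normal (torus a r) x =
     vector [- cos (x $ 1) * cos (x $ 2), - cos (x $ 1) * sin (x $ 2), - sin (x $ 1)]"
proof -
  define N :: "real^3" where
    "N = vector [- cos (x $ 1) * cos (x $ 2), - cos (x $ 1) * sin (x $ 2), - sin (x $ 1)]"
  define w where "w = r * (a + r * cos (x $ 1))"
  have "w > 0"
    unfolding w_def using r_pos torus_radius_pos by simp
  have sc: "(sin (x $ 2))\<^sup>2 = 1 - (cos (x $ 2))\<^sup>2"
    by (simp add: sin_squared_eq)
  have "cross3 (partial_deriv 1 (torus a r) x) (partial_deriv 2 (torus a r) x) = w *\<^sub>R N"
    using sc
    by (simp add: partial_deriv_torus cross3_def N_def w_def vec_eq_iff forall_3) algebra
  moreover have "N \<bullet> N = 1"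
  proof -
    have "N \<bullet> N = cos (x $ 1) * cos (x $ 2) * (cos (x $ 1) * cos (x $ 2))
        + cos (x $ 1) * sin (x $ 2) * (cos (x $ 1) * sin (x $ 2)) + sin (x $ 1) * sin (x $ 1)"
      by (simp add: N_def inner_vec_def sum_3)
    also have "\<dots> = 1"
      using sc sin_squared_eq[of "x $ 1"] by algebra
    finally show ?thesis .
  qed
  then have "norm N = 1"
    by (simp add: norm_eq_1)
  ultimately have "unit_normal (torus a r) x = N"
    using \<open>w > 0\<close> by (simp add: unit_normal_def sgn_scaleR) (simp add: sgn_div_norm)
  then show ?thesis by (simp add: N_def)
qed

lemma second_form_torus:
  "second_form (torus a r) x =
     vector [vector [r, 0], vector [0, (a + r * cos (x $ 1)) * cos (x $ 1)]]"
proof -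
  have s: "(sin t)\<^sup>2 = 1 - (cos t)\<^sup>2" for t :: real by (rule sin_squared_eq)
  show ?thesis
    using s[of "x $ 1"] s[of "x $ 2"]
    apply (simp add: second_form_def partial_deriv2_torus unit_normal_torus vec_eq_iff forall_2
        inner_vec_def sum_3)
    apply (intro conjI; algebra)
    done
qed

lemma matrix_inv_first_form_torus:
  "matrix_inv (first_form (torus a r) x) =
     vector [vector [1 / r\<^sup>2, 0], vector [0, 1 / (a + r * cos (x $ 1))\<^sup>2]]"
proof (rule matrix_inv_eqI)
  have "a + r * cos (x $ 1) \<noteq> 0" using torus_radius_pos[of "x $ 1"] by linarith
  with r_pos
  show "first_form (torus a r) x **
      vector [vector [1 / r\<^sup>2, 0], vector [0, 1 / (a + r * cos (x $ 1))\<^sup>2]] = mat 1"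
    and "vector [vector [1 / r\<^sup>2, 0], vector [0, 1 / (a + r * cos (x $ 1))\<^sup>2]] **
      first_form (torus a r) x = mat 1"
    by (simp_all add: first_form_torus matrix_matrix_mult_def mat_def vec_eq_iff forall_2 sum_2)
qed

lemma mean_curvature_torus:
  "mean_curvature (torus a r) x = 1 / 2 * (1 / r + cos (x $ 1) / (a + r * cos (x $ 1)))"
proof -
  have "a + r * cos (x $ 1) \<noteq> 0" using torus_radius_pos[of "x $ 1"] by linarith
  with r_pos show ?thesis
    by (simp add: mean_curvature_def matrix_inv_first_form_torus second_form_torus trace_def
        matrix_matrix_mult_def sum_2 power2_eq_square)
qed

lemma gauss_curvature_torus:
  "gauss_curvature (torus a r) x = cos (x $ 1) / (r * (a + r * cos (x $ 1)))"
proof -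
  have "a + r * cos (x $ 1) \<noteq> 0" using torus_radius_pos[of "x $ 1"] by linarith
  with r_pos show ?thesis
    by (simp add: gauss_curvature_def first_form_torus second_form_torus det_2 power2_eq_square)
qed

end

end

theory Submission
  imports Defs "HOL-Computational_Algebra.Polynomial"
begin

text \<open>
  All quantities entering the Euler--Lagrange equation are polynomial in
  \<open>y = a / (a + r cos u)\<close>: for instance \<open>H = (2 - y) / (2 r)\<close>.  Writing
  \<open>\<E>(H) = Q(y)\<close>, the equation becomes a third-order linear differential equation for the
  polynomial \<open>Q\<close>, and comparing the coefficients of \<open>y\<^sup>j\<close> gives a three-term recurrence whose
  coefficients all carry the factor \<open>j - 2\<close>.  The top one, \<open>j = n + 1\<close>, says
  \<open>(r\<^sup>2 / a\<^sup>2 - 1) n (n - 1) + 1 = 0\<close>; conversely, if this holds, the recurrence can be solved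
  downwards from the leading coefficient.
\<close>

subsection \<open>The Laplace--Beltrami operator on the torus\<close>

lemma partial_deriv_comp_component:
  assumes "(f has_real_derivative f') (at (x $ 1))"
  shows "partial_deriv 1 (\<lambda>y. f (y $ 1)) x = f'"
    and "partial_deriv 2 (\<lambda>y. f (y $ 1)) x = 0"
proof -
  have "((\<lambda>t. f (x $ 1 + t)) has_real_derivative f') (at 0)"
    using assms DERIV_shift[of f f' 0 "x $ 1"] by (simp add: add.commute)
  then show "partial_deriv 1 (\<lambda>y. f (y $ 1)) x = f'"
    by (intro partial_derivI) (simp add: axis_def has_real_derivative_iff_has_vector_derivative)
  show "partial_deriv 2 (\<lambda>y. f (y $ 1)) x = 0"
    by (intro partial_derivI) (simp add: axis_def)
qed

text \<open>The metric is diagonal and independent of v, so for a function of u alone only the first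
  flux component survives. It equals \<open>w f' / r\<close>, because sqrt(det g) is
  \<open>r w\<close> with w = a + r cos u and g^11 is 1/r^2.\<close>

lemma laplace_beltrami_torus:
  fixes a r :: real
  assumes "0 < r" "r < a"
    and f': "\<And>t. (f has_real_derivative f' t) (at t)"
    and f'': "\<And>t. (f' has_real_derivative f'' t) (at t)"
  shows "laplace_beltrami (torus a r) (\<lambda>y. f (y $ 1)) x =
    (f'' (x $ 1) - r * sin (x $ 1) / (a + r * cos (x $ 1)) * f' (x $ 1)) / r\<^sup>2"
proof -
  define w where "w t = a + r * cos t" for t
  have w_pos: "w t > 0" for t
    using torus_radius_pos[OF assms(1,2)] by (simp add: w_def)
  have sqrt_det: "sqrt (det (first_form (torus a r) y)) = r * w (y $ 1)" for y
    using assms(1) w_pos[of "y $ 1"]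
    by (simp add: first_form_torus[OF assms(1,2)] det_2 w_def real_sqrt_mult)
  have inv: "matrix_inv (first_form (torus a r) y) =
      vector [vector [1 / r\<^sup>2, 0], vector [0, 1 / (w (y $ 1))\<^sup>2]]" for y
    by (simp add: matrix_inv_first_form_torus[OF assms(1,2)] w_def)
  have flux1: "(\<Sum>j\<in>UNIV. sqrt (det (first_form (torus a r) y)) *
      matrix_inv (first_form (torus a r) y) $ 1 $ j * partial_deriv j (\<lambda>y. f (y $ 1)) y)
      = w (y $ 1) * f' (y $ 1) / r" for y
    using assms(1) partial_deriv_comp_component[OF f', of y]
    by (simp add: sum_2 sqrt_det inv power2_eq_square)
  have flux2: "(\<Sum>j\<in>UNIV. sqrt (det (first_form (torus a r) y)) *
      matrix_inv (first_form (torus a r) y) $ 2 $ j * partial_deriv j (\<lambda>y. f (y $ 1)) y) = 0"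
    for y
    using partial_deriv_comp_component[OF f', of y]
    by (simp add: sum_2 inv)
  have "((\<lambda>t. w t * f' t / r) has_real_derivative
      (w t * f'' t - r * sin t * f' t) / r) (at t)" for t
    unfolding w_def using assms(1) by (auto intro!: derivative_eq_intros f'')
  from partial_deriv_comp_component(1)[OF this]
  have div1: "partial_deriv 1 (\<lambda>y. w (y $ 1) * f' (y $ 1) / r) x =
      (w (x $ 1) * f'' (x $ 1) - r * sin (x $ 1) * f' (x $ 1)) / r" .
  have div2: "partial_deriv 2 (\<lambda>y. 0 :: real) x = 0"
    by (rule partial_derivI) simp
  have "laplace_beltrami (torus a r) (\<lambda>y. f (y $ 1)) x =
      1 / (r * w (x $ 1)) * ((w (x $ 1) * f'' (x $ 1) - r * sin (x $ 1) * f' (x $ 1)) / r + 0)"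
    unfolding laplace_beltrami_def sum_2 sqrt_det
      flux1[unfolded sum_2 sqrt_det] flux2[unfolded sum_2 sqrt_det] div1 div2 ..
  also have "\<dots> = (f'' (x $ 1) - r * sin (x $ 1) / w (x $ 1) * f' (x $ 1)) / r\<^sup>2"
    using assms(1) less_imp_neq[OF w_pos[of "x $ 1"]]
    by (simp add: field_simps power2_eq_square)
  finally show ?thesis
    by (simp add: w_def)
qed

subsection \<open>The Euler--Lagrange equation as a polynomial identity\<close>

text \<open>This is the left-hand side of the Euler--Lagrange equation divided by -2/r, with k =
  r^2/a^2 - 1 and s = p r. The four coefficient polynomials are r^2 |grad y|^2, r^2 times the
  Laplacian of y, r^2 (4 H^2 - 2 K) and 2 r H, each expressed in y.\<close>

definition euler_lagrange_poly :: "real \<Rightarrow> real \<Rightarrow> real poly \<Rightarrow> real poly" where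
  "euler_lagrange_poly k s Q =
     [:0, 0, -1, 2, k:] * pderiv (pderiv (pderiv Q)) + [:0, 0, 1, k:] * pderiv (pderiv Q)
     + [:2, -2, 1:] * pderiv Q + [:2, -1:] * Q - [:s:]"

lemma coeff_euler_lagrange_poly_0:
  "coeff (euler_lagrange_poly k s Q) 0 = 2 * coeff Q 0 + 2 * coeff Q 1 - s"
  by (simp add: euler_lagrange_poly_def coeff_pderiv)

text \<open>The operator sends y^m to a combination of y^(m-1), y^m and y^(m+1), so only three
  neighbouring coefficients of Q meet here.\<close>

lemma coeff_euler_lagrange_poly_Suc:
  "coeff (euler_lagrange_poly k s Q) (Suc j) =
     (real j - 1) * ((k * real j * (real j - 1) + 1) * coeff Q j
       + real j * (2 * real j + 3) * coeff Q (Suc j) - (real j + 2)\<^sup>2 * coeff Q (Suc (Suc j)))"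
proof -
  consider "j = 0" | "j = 1" | i where "j = Suc (Suc i)"
    by (metis One_nat_def not0_implies_Suc)
  then show ?thesis
    by cases
      (simp_all add: euler_lagrange_poly_def coeff_pderiv coeff_pCons algebra_simps
        power2_eq_square numeral_2_eq_2 split: nat.split)
qed

text \<open>The factor \<open>real j - 1\<close> makes the condition at y^2 void, hence
  \<open>j \<noteq> 1\<close>. As the factor \<open>real j\<close> kills its term at j = 0,
  \<open>coeff Q 1\<close> then enters only the condition on s.\<close>

lemma euler_lagrange_poly_eq_0_iff:
  "euler_lagrange_poly k s Q = 0 \<longleftrightarrow>
     s = 2 * coeff Q 0 + 2 * coeff Q 1 \<and>
     (\<forall>j. j \<noteq> 1 \<longrightarrow> (k * real j * (real j - 1) + 1) * coeff Q j
       + real j * (2 * real j + 3) * coeff Q (Suc j) = (real j + 2)\<^sup>2 * coeff Q (Suc (Suc j)))"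
proof -
  have "euler_lagrange_poly k s Q = 0 \<longleftrightarrow> coeff (euler_lagrange_poly k s Q) 0 = 0 \<and>
      (\<forall>j. coeff (euler_lagrange_poly k s Q) (Suc j) = 0)"
    by (metis coeff_0 not0_implies_Suc poly_eq_iff)
  moreover have "real j - 1 = 0 \<longleftrightarrow> j = 1" for j
    by auto
  ultimately show ?thesis
    unfolding coeff_euler_lagrange_poly_0 coeff_euler_lagrange_poly_Suc mult_eq_0_iff
    by auto
qed

text \<open>Since y = 2 - 2 r H, the energy Q(y) is the composed polynomial in H, and its
  H-derivative is -2 r Q'(y). The chain rule for the Laplacian, F''(y) |grad y|^2 + F'(y) times the
  Laplacian of y, then leaves only polynomials in y.\<close>

lemma euler_lagrange_torus_pointwise:
  fixes a r :: real
  assumes "0 < r" "r < a"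
  defines "y \<equiv> \<lambda>t. a / (a + r * cos t)"
  shows "laplace_beltrami (torus a r)
        (\<lambda>x. deriv (poly (Q \<circ>\<^sub>p [:2, - 2 * r:])) (mean_curvature (torus a r) x)) x
      + (4 * (mean_curvature (torus a r) x)\<^sup>2 - 2 * gauss_curvature (torus a r) x)
        * deriv (poly (Q \<circ>\<^sub>p [:2, - 2 * r:])) (mean_curvature (torus a r) x)
      - 4 * mean_curvature (torus a r) x * poly (Q \<circ>\<^sub>p [:2, - 2 * r:]) (mean_curvature (torus a r) x)
      + 2 * p
    = - 2 / r * poly (euler_lagrange_poly (r\<^sup>2 / a\<^sup>2 - 1) (p * r) Q) (y (x $ 1))"
proof -
  define t where "t = x $ 1"
  define w where "w t = a + r * cos t" for t
  have w_pos: "w t > 0" for t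
    using torus_radius_pos[OF assms(1,2)] by (simp add: w_def)
  have w_nz: "a + r * cos t \<noteq> 0" for t
    using w_pos[of t] by (simp add: w_def)
  have a_pos: "a > 0" using assms by simp
  have H: "mean_curvature (torus a r) x = (2 - y (x $ 1)) / (2 * r)" for x
    using w_nz assms(1) by (simp add: mean_curvature_torus[OF assms(1,2)] y_def field_simps)
  have cos_y: "r * cos t = a / y t - a" for t
    using w_nz a_pos by (simp add: y_def field_simps)
  have K: "gauss_curvature (torus a r) x = (1 - y (x $ 1)) / r\<^sup>2" for x
  proof -
    have "1 - y (x $ 1) = r * cos (x $ 1) / (a + r * cos (x $ 1))"
      using w_nz by (simp add: y_def field_simps)
    then show ?thesis
      using assms(1) by (simp add: gauss_curvature_torus[OF assms(1,2)] power2_eq_square)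
  qed
  have arg: "poly [:2, - 2 * r:] ((2 - z) / (2 * r)) = z" for z
    using assms(1) by (simp add: field_simps)
  have E: "poly (Q \<circ>\<^sub>p [:2, - 2 * r:]) ((2 - z) / (2 * r)) = poly Q z" for z
    unfolding poly_pcompose arg ..
  have dE: "deriv (poly (Q \<circ>\<^sub>p [:2, - 2 * r:])) ((2 - z) / (2 * r)) =
      - 2 * r * poly (pderiv Q) z" for z
  proof -
    have "deriv (poly (Q \<circ>\<^sub>p [:2, - 2 * r:])) ((2 - z) / (2 * r)) =
        poly (pderiv (Q \<circ>\<^sub>p [:2, - 2 * r:])) ((2 - z) / (2 * r))"
      by (intro DERIV_imp_deriv poly_DERIV)
    also have "\<dots> = - 2 * r * poly (pderiv Q) z"
      unfolding pderiv_pcompose poly_mult poly_pcompose arg by (simp add: pderiv_pCons)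
    finally show ?thesis .
  qed
  define y' where "y' t = (y t)\<^sup>2 * r * sin t / a" for t
  define y'' where "y'' t = 2 * y t * y' t * r * sin t / a + (y t)\<^sup>2 * r * cos t / a" for t
  have y': "(y has_real_derivative y' t) (at t)" for t
    unfolding y_def y'_def using w_nz a_pos
    by (auto intro!: derivative_eq_intros simp: power2_eq_square)
  have y'': "(y' has_real_derivative y'' t) (at t)" for t
    unfolding y'_def[abs_def] y''_def using a_pos
    by (auto intro!: derivative_eq_intros y' simp: field_simps power2_eq_square y'_def)
  have dpoly: "((\<lambda>t. poly R (y t)) has_real_derivative poly (pderiv R) (y t) * y' t) (at t)"
    for R t
    by (rule DERIV_chain2[OF poly_DERIV y'])
  define Q1 where "Q1 = pderiv Q"
  define Q2 where "Q2 = pderiv Q1"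
  define Q3 where "Q3 = pderiv Q2"
  have d1: "((\<lambda>t. - 2 * r * poly Q1 (y t)) has_real_derivative
      - 2 * r * (poly Q2 (y t) * y' t)) (at t)" for t
    unfolding Q2_def by (intro DERIV_cmult dpoly)
  have d2: "((\<lambda>t. - 2 * r * (poly Q2 (y t) * y' t)) has_real_derivative
      - 2 * r * (poly Q3 (y t) * (y' t)\<^sup>2 + poly Q2 (y t) * y'' t)) (at t)" for t
    unfolding Q3_def
    by (rule derivative_eq_intros dpoly y'' refl | simp add: algebra_simps power2_eq_square)+
  have lap: "laplace_beltrami (torus a r) (\<lambda>x. - 2 * r * poly Q1 (y (x $ 1))) x =
      (- 2 * r * (poly Q3 (y t) * (y' t)\<^sup>2 + poly Q2 (y t) * y'' t)
        - r * sin t / (a + r * cos t) * (- 2 * r * (poly Q2 (y t) * y' t))) / r\<^sup>2"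
    unfolding t_def by (rule laplace_beltrami_torus[OF assms(1,2) d1 d2])
  define z where "z = y t"
  have z_pos: "z > 0" using w_pos[of t] a_pos by (simp add: z_def y_def w_def)
  have w_z: "a + r * cos t = a / z"
    using cos_y[of t] by (simp add: z_def)
  have sin2: "r\<^sup>2 * (sin t)\<^sup>2 = r\<^sup>2 - (a / z - a)\<^sup>2"
    unfolding z_def cos_y[symmetric] by (simp add: sin_squared_eq power_mult_distrib right_diff_distrib)
  define k where "k = r\<^sup>2 / a\<^sup>2 - 1"
  \<comment> \<open>The sine is eliminated through r cos t = a/z - a; this is where k
    appears.\<close>
  have sin2': "(sin t)\<^sup>2 * r\<^sup>2 * z\<^sup>2 = a\<^sup>2 * (k * z\<^sup>2 + 2 * z - 1)"
  proof -
    have "k * a\<^sup>2 = r\<^sup>2 - a\<^sup>2"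
      using a_pos by (simp add: k_def field_simps)
    moreover have "(r\<^sup>2 * (sin t)\<^sup>2) * z\<^sup>2 = r\<^sup>2 * z\<^sup>2 - (a - a * z)\<^sup>2"
      unfolding sin2 using z_pos by (simp add: field_simps power2_eq_square)
    ultimately show ?thesis
      by algebra
  qed
  \<comment> \<open>\<open>A\<close> and \<open>B\<close> are r^2 times the squared gradient and r^2
    times the Laplacian of y.\<close>
  have A: "(y' t)\<^sup>2 = z\<^sup>2 * (k * z\<^sup>2 + 2 * z - 1)"
  proof -
    have "(y' t)\<^sup>2 = z\<^sup>2 * ((sin t)\<^sup>2 * r\<^sup>2 * z\<^sup>2) / a\<^sup>2"
      by (simp add: y'_def z_def power2_eq_square)
    then show ?thesis
      unfolding sin2' using a_pos by simp
  qed
  have B: "y'' t - r * sin t / (a + r * cos t) * y' t = k * z^3 + z\<^sup>2"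
  proof -
    have "y'' t = 2 * z * ((sin t)\<^sup>2 * r\<^sup>2 * z\<^sup>2) / a\<^sup>2 + z\<^sup>2 * (a / z - a) / a"
      using cos_y[of t] by (simp add: y''_def y'_def z_def power2_eq_square mult.assoc)
    moreover have "r * sin t / (a + r * cos t) * y' t = z * ((sin t)\<^sup>2 * r\<^sup>2 * z\<^sup>2) / a\<^sup>2"
      unfolding w_z y'_def z_def[symmetric] by (simp add: power2_eq_square)
    ultimately have "y'' t - r * sin t / (a + r * cos t) * y' t =
        z * (a\<^sup>2 * (k * z\<^sup>2 + 2 * z - 1)) / a\<^sup>2 + z\<^sup>2 * (a / z - a) / a"
      unfolding sin2' by (simp add: field_simps)
    also have "\<dots> = z * (k * z\<^sup>2 + 2 * z - 1) + z\<^sup>2 * (1 / z - 1)"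
      using a_pos by (simp add: field_simps)
    also have "\<dots> = k * z^3 + z\<^sup>2"
      using z_pos by (simp add: field_simps power2_eq_square power3_eq_cube)
    finally show ?thesis .
  qed
  have scale: "(- 2 * r * b - m * (- 2 * r * c)) / r\<^sup>2 = - 2 / r * (b - m * c)" for b c m
    using assms(1) by (simp add: field_simps power2_eq_square)
  have "laplace_beltrami (torus a r) (\<lambda>x. - 2 * r * poly Q1 (y (x $ 1))) x =
      - 2 / r * (poly Q3 z * (y' t)\<^sup>2 + poly Q2 z * (y'' t - r * sin t / (a + r * cos t) * y' t))"
    unfolding lap z_def[symmetric] scale
    by (simp add: algebra_simps)
  then have lap': "laplace_beltrami (torus a r) (\<lambda>x. - 2 * r * poly Q1 (y (x $ 1))) x =
      - 2 / r * (poly Q3 z * (z\<^sup>2 * (k * z\<^sup>2 + 2 * z - 1)) + poly Q2 z * (k * z^3 + z\<^sup>2))"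
    unfolding A B .
  have curv: "4 * ((2 - z) / (2 * r))\<^sup>2 - 2 * ((1 - z) / r\<^sup>2) = (z\<^sup>2 - 2 * z + 2) / r\<^sup>2"
    using assms(1) by (simp add: field_simps power2_eq_square)
  show ?thesis
    unfolding H K E dE Q1_def[symmetric] lap' t_def[symmetric] z_def[symmetric] curv
      euler_lagrange_poly_def k_def[symmetric] Q2_def[symmetric] Q3_def[symmetric]
    using assms(1)
    by (simp add: field_simps power2_eq_square power3_eq_cube)
qed

text \<open>As u varies, y takes infinitely many values, so a polynomial in y that vanishes on the
  whole torus is zero.\<close>

lemma critical_point_torus_poly_iff:
  fixes a r :: real
  assumes "0 < r" "r < a"
  shows "critical_point (torus a r) (poly (Q \<circ>\<^sub>p [:2, - 2 * r:])) p \<longleftrightarrow>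
    euler_lagrange_poly (r\<^sup>2 / a\<^sup>2 - 1) (p * r) Q = 0"
proof -
  let ?L = "euler_lagrange_poly (r\<^sup>2 / a\<^sup>2 - 1) (p * r) Q"
  have surj: "\<exists>x::real^2. x $ 1 = t" for t
    by (rule exI[of _ "vec t"]) simp
  have "critical_point (torus a r) (poly (Q \<circ>\<^sub>p [:2, - 2 * r:])) p \<longleftrightarrow>
      (\<forall>t. poly ?L (a / (a + r * cos t)) = 0)"
    unfolding critical_point_def euler_lagrange_torus_pointwise[OF assms]
    using assms(1) surj by (auto, metis)
  also have "\<dots> \<longleftrightarrow> ?L = 0"
  proof
    assume *: "\<forall>t. poly ?L (a / (a + r * cos t)) = 0"
    \<comment> \<open>Parametrizing by c = cos u instead of u makes the map to y injective.\<close>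
    have "inj_on (\<lambda>c. a / (a + r * c)) {-1..1}"
    proof (rule inj_onI)
      fix c d assume cd: "c \<in> {-1..1}" "d \<in> {-1..1}" "a / (a + r * c) = a / (a + r * d)"
      have "a + r * c > 0" "a + r * d > 0"
        using torus_radius_pos[OF assms, of "arccos c"] torus_radius_pos[OF assms, of "arccos d"] cd
        by auto
      with cd(3) assms show "c = d" by (simp add: field_simps)
    qed
    moreover have "infinite {-1..1::real}"
      by simp
    ultimately have "infinite ((\<lambda>c. a / (a + r * c)) ` {-1..1})"
      using finite_imageD by blast
    moreover have "(\<lambda>c. a / (a + r * c)) ` {-1..1} \<subseteq> {z. poly ?L z = 0}"
    proof clarify
      fix c :: real assume "c \<in> {-1..1}"
      then show "poly ?L (a / (a + r * c)) = 0"
        using *[rule_format, of "arccos c"] by simp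
    qed
    ultimately show "?L = 0"
      using finite_subset poly_roots_finite by blast
  qed simp
  finally show ?thesis .
qed

subsection \<open>Solving the recurrence\<close>

text \<open>The sequence runs downwards: \<open>euler_lagrange_coeff n k i\<close> is the coefficient of
  \<open>y\<close> to the power \<open>n + 1 - i\<close>.\<close>

fun euler_lagrange_coeff :: "nat \<Rightarrow> real \<Rightarrow> nat \<Rightarrow> real" where
  "euler_lagrange_coeff n k 0 = 0"
| "euler_lagrange_coeff n k (Suc 0) = 1"
| "euler_lagrange_coeff n k (Suc (Suc i)) =
     (let j = real n - 1 - real i in
       ((j + 2)\<^sup>2 * euler_lagrange_coeff n k i
         - j * (2 * j + 3) * euler_lagrange_coeff n k (Suc i)) / (k * j * (j - 1) + 1))"

lemma euler_lagrange_poly_solvable: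
  assumes "n \<ge> 2" and k: "k * real n * (real n - 1) + 1 = 0"
  shows "\<exists>Q s. degree Q = n \<and> euler_lagrange_poly k s Q = 0"
proof -
  \<comment> \<open>The equation at j = 0 forces the constant term to be 4 times the coefficient of
    y^2, which has index n - 1 in the downward sequence. The coefficient of y is free and set to
    0.\<close>
  define q where "q m = (if m = 0 then 4 * euler_lagrange_coeff n k (n - 1)
      else if m = 1 then 0 else euler_lagrange_coeff n k (n + 1 - m))" for m
  define Q where "Q = (\<Sum>m\<le>n. monom (q m) m)"
  have coeff_Q: "coeff Q j = (if j \<le> n then q j else 0)" for j
    by (simp add: Q_def coeff_sum)
  have q_big: "coeff Q j = euler_lagrange_coeff n k (n + 1 - j)" if "j \<ge> 2" for j
    using that by (auto simp: coeff_Q q_def)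
  have "coeff Q n = 1"
    using assms(1) by (simp add: q_big)
  then have deg: "degree Q = n"
    by (metis coeff_Q degree_le le_antisym le_degree linorder_not_less zero_neq_one)
  have "(k * real j * (real j - 1) + 1) * coeff Q j + real j * (2 * real j + 3) * coeff Q (Suc j)
      = (real j + 2)\<^sup>2 * coeff Q (Suc (Suc j))" if "j \<noteq> 1" for j
  proof -
    have "j = 0 \<or> 2 \<le> j \<and> j < n \<or> j = n \<or> j > n"
      using that by arith
    then consider "j = 0" | "2 \<le> j" "j < n" | "j = n" | "j > n"
      by blast
    then show ?thesis
    proof cases
      case 1
      then show ?thesis
        using assms(1) by (simp add: coeff_Q q_def numeral_2_eq_2)
    next
      case 2
      define i where "i = n - 1 - j"
      have idx: "n + 1 - j = Suc (Suc i)" "n + 1 - Suc j = Suc i" "n + 1 - Suc (Suc j) = i"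
        and j: "real n - 1 - real i = real j"
        using 2 by (auto simp: i_def)
      \<comment> \<open>The divisor in the recurrence is nonzero below the top: k n (n - 1) = -1
        makes k negative, so j (j - 1) < n (n - 1) gives k j (j - 1) > -1.\<close>
      have "real j * (real j - 1) < real n * (real n - 1)"
        using 2 by (intro mult_strict_mono) auto
      moreover have "k < 0"
      proof (rule ccontr)
        assume "\<not> k < 0"
        then have "0 \<le> k * real n * (real n - 1)"
          using assms(1) by (intro mult_nonneg_nonneg) auto
        with k show False by linarith
      qed
      ultimately have "k * (real j * (real j - 1)) > k * (real n * (real n - 1))"
        by (rule mult_strict_left_mono_neg)
      then have "k * real j * (real j - 1) + 1 \<noteq> 0"
        using k by (simp add: mult.assoc)
      then show ?thesis
        using 2 by (simp add: q_big idx[simplified] j Let_def del: mult_eq_0_iff)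
    next
      case 3
      then show ?thesis
        using k by (simp add: coeff_Q)
    next
      case 4
      then show ?thesis
        by (simp add: coeff_Q)
    qed
  qed
  then have "euler_lagrange_poly k (2 * coeff Q 0 + 2 * coeff Q 1) Q = 0"
    by (simp add: euler_lagrange_poly_eq_0_iff)
  with deg show ?thesis by blast
qed

text \<open>For necessity, the condition at j = n involves only the leading coefficient, the two
  higher ones being zero; n >= 2 keeps j = n away from the void index 1.\<close>

lemma euler_lagrange_poly_solvable_iff:
  assumes "n \<ge> 2"
  shows "(\<exists>Q s. degree Q = n \<and> euler_lagrange_poly k s Q = 0) \<longleftrightarrow>
    k * real n * (real n - 1) + 1 = 0"
proof
  assume "\<exists>Q s. degree Q = n \<and> euler_lagrange_poly k s Q = 0"
  then obtain Q s where Q: "degree Q = n" "euler_lagrange_poly k s Q = 0"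
    by blast
  have "coeff Q n \<noteq> 0"
    using Q(1) assms by (metis degree_0 leading_coeff_0_iff not_numeral_le_zero)
  moreover have "(k * real n * (real n - 1) + 1) * coeff Q n = 0"
    using Q assms coeff_eq_0[of Q "Suc n"] coeff_eq_0[of Q "Suc (Suc n)"]
    by (auto simp: euler_lagrange_poly_eq_0_iff dest!: conjunct2 spec[of _ n])
  ultimately show "k * real n * (real n - 1) + 1 = 0"
    by (simp only: mult_eq_0_iff) simp
qed (use euler_lagrange_poly_solvable[OF assms] in blast)

section \<open>Energies as polynomials of exact degree n, and affine changes of variable\<close>

lemma poly_energy_eq_poly:
  "poly_energy n c = poly (\<Sum>m\<le>n. monom (c (n + 1 - m)) m)"
proof
  fix H
  have "poly_energy n c H = (\<Sum>m\<le>n. c (n + 1 - m) * H ^ m)"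
    unfolding poly_energy_def
    by (rule sum.reindex_bij_witness[of _ "\<lambda>m. n + 1 - m" "\<lambda>i. n + 1 - i"]) auto
  then show "poly_energy n c H = poly (\<Sum>m\<le>n. monom (c (n + 1 - m)) m) H"
    by (simp add: poly_sum poly_monom)
qed

text \<open>The condition on \<open>c 1\<close> says that the degree is exactly n. The predicate
  \<Phi> will be criticality for some pressure p.\<close>

lemma poly_energy_iff_degree:
  assumes "n \<ge> 1"
  shows "(\<exists>c. c 1 \<noteq> 0 \<and> \<Phi> (poly_energy n c)) \<longleftrightarrow> (\<exists>P. degree P = n \<and> \<Phi> (poly P))"
proof
  assume "\<exists>c. c 1 \<noteq> 0 \<and> \<Phi> (poly_energy n c)"
  then obtain c where c: "c 1 \<noteq> 0" "\<Phi> (poly_energy n c)"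
    by blast
  define P where "P = (\<Sum>m\<le>n. monom (c (n + 1 - m)) m)"
  have coeff_P: "coeff P j = (if j \<le> n then c (n + 1 - j) else 0)" for j
    by (simp add: P_def coeff_sum)
  have "coeff P n \<noteq> 0"
    using c(1) by (simp add: coeff_P)
  then have "degree P = n"
    by (intro antisym degree_le le_degree) (auto simp: coeff_P)
  with c(2) show "\<exists>P. degree P = n \<and> \<Phi> (poly P)"
    unfolding poly_energy_eq_poly P_def[symmetric] by blast
next
  assume "\<exists>P. degree P = n \<and> \<Phi> (poly P)"
  then obtain P where P: "degree P = n" "\<Phi> (poly P)"
    by blast
  define c where "c i = coeff P (n + 1 - i)" for i
  have "(\<Sum>m\<le>n. monom (c (n + 1 - m)) m) = (\<Sum>m\<le>degree P. monom (coeff P m) m)"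
    by (intro sum.cong) (auto simp: c_def P(1))
  then have "poly_energy n c = poly P"
    by (simp add: poly_energy_eq_poly poly_as_sum_of_monoms)
  moreover have "c 1 \<noteq> 0"
    using P(1) assms by (metis add_diff_cancel_right' c_def degree_0 leading_coeff_0_iff not_one_le_zero)
  ultimately show "\<exists>c. c 1 \<noteq> 0 \<and> \<Phi> (poly_energy n c)"
    using P(2) by metis
qed

text \<open>An affine substitution with nonzero slope is invertible and preserves degree. It is
  needed for y = 2 - 2 r H, to pass from polynomials in H to polynomials in y.\<close>

lemma ex_degree_pcompose_linear_iff:
  fixes \<Phi> :: "real poly \<Rightarrow> bool"
  assumes "d \<noteq> 0"
  shows "(\<exists>P. degree P = n \<and> \<Phi> P) \<longleftrightarrow> (\<exists>Q. degree Q = n \<and> \<Phi> (Q \<circ>\<^sub>p [:c, d:]))"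
proof
  assume "\<exists>P. degree P = n \<and> \<Phi> P"
  then obtain P where P: "degree P = n" "\<Phi> P"
    by blast
  have "[:- c / d, 1 / d:] \<circ>\<^sub>p [:c, d:] = [:0, 1:]"
    using assms by (simp add: pcompose_pCons)
  then have "P \<circ>\<^sub>p [:- c / d, 1 / d:] \<circ>\<^sub>p [:c, d:] = P"
    by (simp flip: pcompose_assoc)
  moreover have "degree (P \<circ>\<^sub>p [:- c / d, 1 / d:]) = n"
    using assms P(1) by (simp add: degree_pcompose)
  ultimately show "\<exists>Q. degree Q = n \<and> \<Phi> (Q \<circ>\<^sub>p [:c, d:])"
    using P(2) by metis
next
  assume "\<exists>Q. degree Q = n \<and> \<Phi> (Q \<circ>\<^sub>p [:c, d:])"
  then obtain Q where "degree Q = n" "\<Phi> (Q \<circ>\<^sub>p [:c, d:])"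
    by blast
  then show "\<exists>P. degree P = n \<and> \<Phi> P"
    using assms by (intro exI[of _ "Q \<circ>\<^sub>p [:c, d:]"]) (simp add: degree_pcompose)
qed

theorem theorem1:
  fixes n :: nat and a r :: real
  assumes "n \<ge> 2" and "0 < r" and "r < a"
  shows "(\<exists>(c :: nat \<Rightarrow> real) (p :: real).
            c 1 \<noteq> 0 \<and> critical_point (torus a r) (poly_energy n c) p)
         \<longleftrightarrow> a\<^sup>2 / r\<^sup>2 = (real n ^ 2 - real n) / (real n ^ 2 - real n - 1)"
proof -
  define k where "k = r\<^sup>2 / a\<^sup>2 - 1"
  have "(\<exists>c p. c 1 \<noteq> 0 \<and> critical_point (torus a r) (poly_energy n c) p) \<longleftrightarrow>
      (\<exists>c. c 1 \<noteq> 0 \<and> (\<exists>p. critical_point (torus a r) (poly_energy n c) p))"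
    by blast
  also have "\<dots> \<longleftrightarrow> (\<exists>P. degree P = n \<and> (\<exists>p. critical_point (torus a r) (poly P) p))"
    using assms(1) by (intro poly_energy_iff_degree) simp
  also have "\<dots> \<longleftrightarrow> (\<exists>Q. degree Q = n \<and>
      (\<exists>p. critical_point (torus a r) (poly (Q \<circ>\<^sub>p [:2, - 2 * r:])) p))"
    using assms(2) by (intro ex_degree_pcompose_linear_iff) simp
  also have "\<dots> \<longleftrightarrow> (\<exists>Q. degree Q = n \<and> (\<exists>p. euler_lagrange_poly k (p * r) Q = 0))"
    unfolding critical_point_torus_poly_iff[OF assms(2,3)] k_def ..
  also have "\<dots> \<longleftrightarrow> (\<exists>Q s. degree Q = n \<and> euler_lagrange_poly k s Q = 0)"
  proof -
    \<comment> \<open>Since r is nonzero, p = s / r realizes every constant s, so the pressure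
      imposes no restriction.\<close>
    have "(\<exists>p. euler_lagrange_poly k (p * r) Q = 0) \<longleftrightarrow> (\<exists>s. euler_lagrange_poly k s Q = 0)" for Q
      using assms(2) by (metis less_irrefl nonzero_divide_eq_eq)
    then show ?thesis by blast
  qed
  also have "\<dots> \<longleftrightarrow> k * real n * (real n - 1) + 1 = 0"
    by (rule euler_lagrange_poly_solvable_iff[OF assms(1)])
  also have "\<dots> \<longleftrightarrow> a\<^sup>2 / r\<^sup>2 = (real n ^ 2 - real n) / (real n ^ 2 - real n - 1)"
  proof -
    \<comment> \<open>This makes n^2 - n - 1 positive, so that denominators can be cleared.\<close>
    have "2 * 1 \<le> real n * (real n - 1)"
      using assms(1) by (intro mult_mono) auto
    then have "real n ^ 2 - real n - 1 > 0"
      by (simp add: power2_eq_square algebra_simps)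
    moreover have "a \<noteq> 0" "r \<noteq> 0"
      using assms(2,3) by auto
    ultimately show ?thesis
      by (auto simp: k_def field_simps power2_eq_square)
  qed
  finally show ?thesis .
qed

end
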